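(* Let $1\le p<\infty$ and let $\boldsymbol{w(k)}=(w_n(k))_{n\in\mathbb{N}}$, $k\in\mathbb{N}$, be countably many weights such that each weighted backward shift $B_{\boldsymbol{w(k)}}$ is a continuous operator on the complex Banach space $\ell_p$. Assume that $\inf_{k\in\mathbb{N}}|W_n(k)|>0$ for every $n\in\mathbb{N}$, and that for every $k\in\mathbb{N}$ there exist $C_k>0$, $\tau_k>0$ with $|W_n(k)|^{-p}\le C_kn^{-1}[\log(n+1)]^{-(1+\frac p2+\tau_k)}$ for all $n\ge1$. Suppose there exist integers $2\le\gamma<m$ and an increasing sequence $(\alpha_l)$ of positive real numbers with $\alpha_l\to\infty$ and, for some $\tilde\varepsilon>0$, $\sum_{i=0}^l\alpha_i=\mathcal{O}\big(l^2/(\log l)^{1+\tilde\varepsilon}\big)$, such that for every $k\ge1$ \[ \sum_{n\ge1}\sup\big\{R_n(k,l):\ l\in[m^n,\gamma m^n]\cap\mathbb{N}\big\}<\infty, \] where \[ R_n(k,l)=\sum_{j=\lfloor\alpha_l\rfloor+1}^{m^{n+1}-l-1}\frac{1}{|W_j(k)|^p}+\sum_{j\ge m^{n+1}}\left|\frac{W_j(k)}{W_{j-l}(k)\,\inf_i|W_j(i)|}\right|^p . \] Then there exists a random vector with values in $\ell_p$ that is almost surely a common frequently hypercyclic vector for the family $(B_{\boldsymbol{w(k)}})_{k\in\mathbb{N}}$.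
   Context: $\ell_p$ is the space of complex sequences $(x_n)_{n\ge0}$ with finite $\|x\|_p$, unit vectors $(e_n)_{n\ge0}$. A weight is a bounded sequence of nonzero complex numbers; $B_{\boldsymbol w}e_0=0$, $B_{\boldsymbol w}e_n=w_ne_{n-1}$. $W_n(k)=w_1(k)\cdots w_n(k)$, $W_0(k)=1$. A vector $x$ is frequently hypercyclic for $T$ if for every nonempty open $U$, $\{n: T^nx\in U\}$ has positive lower density ($\liminf_n\#(\cdot\cap[1,n])/n>0$); a common frequently hypercyclic vector is frequently hypercyclic for every member of the family. *)

theory Defs
  imports "HOL-Probability.Probability" "HOL-Library.Landau_Symbols"
begin

definition lp :: "real \<Rightarrow> (nat \<Rightarrow> complex) set" where
  "lp p = {x. summable (\<lambda>n. norm (x n) powr p)}"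

definition lp_norm :: "real \<Rightarrow> (nat \<Rightarrow> complex) \<Rightarrow> real" where
  "lp_norm p x = (\<Sum>n. norm (x n) powr p) powr (1 / p)"

definition lp_open :: "real \<Rightarrow> (nat \<Rightarrow> complex) set \<Rightarrow> bool" where
  "lp_open p U \<longleftrightarrow> U \<subseteq> lp p \<and>
     (\<forall>x\<in>U. \<exists>e>0. \<forall>y\<in>lp p. lp_norm p (y - x) < e \<longrightarrow> y \<in> U)"

definition pos_lower_density :: "nat set \<Rightarrow> bool" where
  "pos_lower_density A \<longleftrightarrow>
     liminf (\<lambda>n. ereal (real (card (A \<inter> {1..n})) / real n)) > 0"

definition freq_hypercyclic ::
  "real \<Rightarrow> ((nat \<Rightarrow> complex) \<Rightarrow> (nat \<Rightarrow> complex)) \<Rightarrow> (nat \<Rightarrow> complex) \<Rightarrow> bool" where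
  "freq_hypercyclic p T x \<longleftrightarrow> x \<in> lp p \<and>
     (\<forall>U. lp_open p U \<and> U \<noteq> {} \<longrightarrow> pos_lower_density {n. (T ^^ n) x \<in> U})"

text \<open>Weighted backward shift: B e_0 = 0, B e_n = w_n e_(n-1), i.e. (B x)_n = w_(n+1) x_(n+1).\<close>
definition bshift :: "(nat \<Rightarrow> complex) \<Rightarrow> (nat \<Rightarrow> complex) \<Rightarrow> (nat \<Rightarrow> complex)" where
  "bshift w x = (\<lambda>n. w (Suc n) * x (Suc n))"

definition Wprod :: "(nat \<Rightarrow> complex) \<Rightarrow> nat \<Rightarrow> complex" where
  "Wprod w n = (\<Prod>i\<in>{1..n}. w i)"

definition is_weight :: "(nat \<Rightarrow> complex) \<Rightarrow> bool" where
  "is_weight w \<longleftrightarrow> (\<forall>n\<ge>1. w n \<noteq> 0) \<and> (\<exists>M. \<forall>n. norm (w n) \<le> M)"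

text \<open>R_n(k,l), with values in [0,infinity] (the tail series may diverge).
  The family is w k, k >= 1; the infimum inf_i |W_j(i)| ranges over i >= 1.\<close>
definition Rterm :: "(nat \<Rightarrow> nat \<Rightarrow> complex) \<Rightarrow> (nat \<Rightarrow> real) \<Rightarrow> real \<Rightarrow> nat \<Rightarrow> nat \<Rightarrow> nat \<Rightarrow> nat \<Rightarrow> ennreal" where
  "Rterm w \<alpha> p m n k l =
     ennreal (\<Sum>j\<in>{nat \<lfloor>\<alpha> l\<rfloor> + 1 .. m ^ (n + 1) - l - 1}. 1 / norm (Wprod (w k) j) powr p)
   + (\<Sum>i. ennreal (norm (Wprod (w k) (i + m ^ (n + 1)) /
          (Wprod (w k) (i + m ^ (n + 1) - l) * (INF i'\<in>{1..}. norm (Wprod (w i') (i + m ^ (n + 1))))))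
          powr p))"

end

theory Submission
  imports Defs "HOL-Library.Log_Nat"
begin

text \<open>
  A constant random vector suffices, so it is enough to find one common frequently hypercyclic vector \<open>x\<close>.
  Enumerate the targets: a weight \<open>w (\<kappa> s)\<close>, a finitely supported vector \<open>y s\<close> and an accuracy.
  Assign to each block \<open>[m ^ n, m ^ (n + 1))\<close> one target \<open>s\<close>, so that every target recurs with bounded gaps in \<open>n\<close>,
  and fill the block with the \<open>D s\<close>-periodic copy of \<open>y s i * W i\<close>, divided by \<open>W j\<close>, where \<open>W\<close> are the weight products
  of \<open>w (\<kappa> s)\<close>. If \<open>l \<in> [m ^ n, 2 m ^ n]\<close> is a multiple of \<open>D s\<close>, then \<open>B ^ l x\<close> agrees with \<open>y s\<close> on the first \<open>D s\<close>
  coordinates; the rest of the block contributes at most a tail of \<open>\<Sum> 1 / |W i| ^ p\<close>, small for \<open>D s\<close> large,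
  and the later blocks are controlled by the second sum in \<open>R_n(k,l)\<close>. To compensate for the unbounded
  sizes of the targets, target \<open>s\<close> is only used beyond a large threshold \<open>N s\<close>.
  These \<open>l\<close> have positive lower density since blocks grow geometrically.
\<close>

subsection \<open>Series with values in the extended nonnegative reals\<close>

text \<open>Tonelli for the counting measure.\<close>

lemma ennreal_suminf_swap:
  fixes f :: "nat \<Rightarrow> nat \<Rightarrow> ennreal"
  shows "(\<Sum>i. \<Sum>j. f i j) = (\<Sum>j. \<Sum>i. f i j)"
  using nn_integral_suminf[of "\<lambda>j i. f i j" "count_space UNIV"]
  by (simp add: nn_integral_count_space_nat)

lemma ennreal_suminf_tail_tendsto_0:
  fixes f :: "nat \<Rightarrow> ennreal"
  assumes "(\<Sum>i. f i) < \<top>"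
  shows "(\<lambda>N. \<Sum>i. f (i + N)) \<longlonglongrightarrow> 0"
proof -
  define g where "g i = enn2real (f i)" for i
  have "f i < \<top>" for i using assms
    by (metis ennreal_suminf_lessD)
  then have f: "f i = ennreal (g i)" for i by (simp add: g_def)
  have g: "g i \<ge> 0" for i by (simp add: g_def)
  have s: "summable g"
    using assms by (intro summable_suminf_not_top) (auto simp: g f)
  have "(\<Sum>i. f (i + N)) = ennreal (\<Sum>i. g (i + N))" for N
    unfolding f by (rule suminf_ennreal2) (use g s in \<open>auto simp: summable_iff_shift\<close>)
  moreover have "(\<lambda>N. \<Sum>i. g (i + N)) \<longlonglongrightarrow> 0"
    by (rule suminf_exist_split2[OF s])
  ultimately show ?thesis by (simp flip: ennreal_0) 
qed

lemma ennreal_suminf_tail_le: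
  fixes f :: "nat \<Rightarrow> ennreal"
  shows "(\<Sum>i. f (i + N)) \<le> (\<Sum>i. f i)"
  using suminf_offset[of f N] by (simp add: le_iff_add add.commute)

text \<open>Turns an activation threshold inside a series into a tail of that series.\<close>

lemma ennreal_suminf_cut:
  fixes g :: "nat \<Rightarrow> ennreal"
  shows "(\<Sum>j. c * of_bool (n \<le> j) * g j) = c * (\<Sum>j. g (j + n))"
  by (subst suminf_offset[of _ n]) (auto simp: ennreal_suminf_cmult)

text \<open>For \<open>l \<ge> L\<close> the full sums are below \<open>e\<close>, hence so are
  their tails; the finitely many \<open>l < L\<close> each have small tails eventually.\<close>

lemma uniform_tail:
  fixes f :: "nat \<Rightarrow> nat \<Rightarrow> ennreal"
  assumes fin: "\<And>l. (\<Sum>j. f l j) < \<top>" and lim: "(\<lambda>l. \<Sum>j. f l j) \<longlonglongrightarrow> 0" and e: "e > 0"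
  shows "\<exists>N0. \<forall>N\<ge>N0. \<forall>l. (\<Sum>j. f l (j + N)) < e"
proof -
  from order_tendstoD(2)[OF lim e] obtain L where L: "\<And>l. l \<ge> L \<Longrightarrow> (\<Sum>j. f l j) < e"
    by (auto simp: eventually_sequentially)
  have "eventually (\<lambda>N. \<forall>l\<in>{..<L}. (\<Sum>j. f l (j + N)) < e) sequentially"
    using order_tendstoD(2)[OF ennreal_suminf_tail_tendsto_0[OF fin] e]
    by (intro eventually_ball_finite) auto
  then obtain N0 where "\<And>N l. N \<ge> N0 \<Longrightarrow> l < L \<Longrightarrow> (\<Sum>j. f l (j + N)) < e"
    by (auto simp: eventually_sequentially)
  moreover have "(\<Sum>j. f l (j + N)) < e" if "l \<ge> L" for l N
    using ennreal_suminf_tail_le L[OF that] by (rule le_less_trans)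
  ultimately show ?thesis by (meson not_le_imp_less)
qed

lemma ennreal_half_power_suminf: "(\<Sum>s. ennreal ((1/2) ^ (s + a))) = ennreal (2 * (1/2) ^ a)"
proof -
  have "(\<lambda>s. (1/2) ^ a * (1/2::real) ^ s) sums ((1/2) ^ a * (1 / (1 - 1/2)))"
    by (intro sums_mult geometric_sums) auto
  then have "(\<lambda>s. (1/2::real) ^ (s + a)) sums (2 * (1/2) ^ a)"
    by (simp add: power_add mult_ac)
  then show ?thesis by (intro suminf_ennreal_eq) auto
qed

text \<open>For each \<open>s\<close>, the terms \<open>f k l\<close> with \<open>k \<le> s\<close> have tails that are small uniformly in \<open>l\<close>, so
  \<open>N s\<close> can be chosen such that everything carrying the factor \<open>c s\<close> is at most \<open>(1/2) ^ s\<close>; then only finitely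
  many \<open>s\<close> matter for a given accuracy.\<close>

lemma slow_activation:
  fixes f :: "nat \<Rightarrow> nat \<Rightarrow> nat \<Rightarrow> ennreal" and c :: "nat \<Rightarrow> real" and h :: "nat \<Rightarrow> nat \<Rightarrow> ennreal"
  assumes fin: "\<And>k l. (\<Sum>j. f k l j) < \<top>" and lim: "\<And>k. (\<lambda>l. \<Sum>j. f k l j) \<longlonglongrightarrow> 0"
    and h: "\<And>s. (\<Sum>j. h s j) < \<top>"
  obtains N :: "nat \<Rightarrow> nat" where
    "\<And>k. (\<lambda>l. \<Sum>j. (\<Sum>s. ennreal (c s) * of_bool (N s \<le> j)) * f k l j) \<longlonglongrightarrow> 0"
    "(\<Sum>j. \<Sum>s. ennreal (c s) * of_bool (N s \<le> j) * h s j) < \<top>"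
proof -
  have "\<exists>N. (\<forall>k\<le>s. \<forall>l. ennreal (c s) * (\<Sum>j. f k l (j + N)) \<le> ennreal ((1/2)^s)) \<and>
      ennreal (c s) * (\<Sum>j. h s (j + N)) \<le> ennreal ((1/2)^s)" for s
  proof -
    define e where "e = ennreal ((1/2) ^ s / (1 + \<bar>c s\<bar>))"
    have "e > 0" by (auto simp: e_def add_pos_nonneg)
    have e: "ennreal (c s) * x \<le> ennreal ((1/2)^s)" if "x < e" for x
    proof -
      have "ennreal (c s) * x \<le> ennreal (1 + \<bar>c s\<bar>) * e"
        using that by (intro mult_mono ennreal_leI) auto
      also have "\<dots> = ennreal ((1/2)^s)" unfolding e_def
        by (subst ennreal_mult[symmetric]) (auto simp: field_simps add_nonneg_eq_0_iff)
      finally show ?thesis .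
    qed
    \<comment> \<open>Only \<open>k \<le> s\<close> is demanded, so finitely many conditions are
      intersected; a fixed \<open>k\<close> is still covered for all
      \<open>s \<ge> k\<close>.\<close>
    have "eventually (\<lambda>N. \<forall>k\<in>{..s}. \<forall>l. (\<Sum>j. f k l (j + N)) < e) sequentially"
      using uniform_tail[OF fin lim \<open>e > 0\<close>]
      by (intro eventually_ball_finite) (auto simp: eventually_sequentially)
    moreover have "eventually (\<lambda>N. (\<Sum>j. h s (j + N)) < e) sequentially"
      by (rule order_tendstoD(2)[OF ennreal_suminf_tail_tendsto_0[OF h] \<open>e > 0\<close>])
    ultimately have "eventually (\<lambda>N. (\<forall>k\<in>{..s}. \<forall>l. (\<Sum>j. f k l (j + N)) < e) \<and> (\<Sum>j. h s (j + N)) < e) sequentially"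
      by eventually_elim auto
    then obtain N where "\<forall>k\<in>{..s}. \<forall>l. (\<Sum>j. f k l (j + N)) < e" "(\<Sum>j. h s (j + N)) < e"
      by (auto simp: eventually_sequentially)
    then show ?thesis by (intro exI[of _ N]) (auto intro: e)
  qed
  then obtain N where N: "\<And>s k l. k \<le> s \<Longrightarrow> ennreal (c s) * (\<Sum>j. f k l (j + N s)) \<le> ennreal ((1/2)^s)"
      and Nh: "\<And>s. ennreal (c s) * (\<Sum>j. h s (j + N s)) \<le> ennreal ((1/2)^s)" by metis
  have "(\<Sum>j. \<Sum>s. ennreal (c s) * of_bool (N s \<le> j) * h s j) = (\<Sum>s. ennreal (c s) * (\<Sum>j. h s (j + N s)))"
    by (subst ennreal_suminf_swap) (simp add: ennreal_suminf_cut)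
  also have "\<dots> \<le> (\<Sum>s. ennreal ((1/2)^s))" by (intro suminf_le Nh) auto
  also have "\<dots> < \<top>" using ennreal_half_power_suminf[of 0] by simp
  finally have 2: "(\<Sum>j. \<Sum>s. ennreal (c s) * of_bool (N s \<le> j) * h s j) < \<top>" .
  have "(\<lambda>l. \<Sum>j. (\<Sum>s. ennreal (c s) * of_bool (N s \<le> j)) * f k l j) \<longlonglongrightarrow> 0" for k
  proof (rule order_tendstoI)
    fix e :: ennreal assume "0 < e"
    \<comment> \<open>\<open>s0 \<ge> k\<close> puts every \<open>s \<ge> s0\<close> under the
      geometric bound, with total below \<open>e\<close>; the contribution of the finitely many
      \<open>s < s0\<close> vanishes as \<open>l\<close> grows.\<close>
    obtain s0 where s0: "s0 \<ge> k" "ennreal (2 * (1/2) ^ s0) < e"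
    proof -
      have "(\<lambda>s. ennreal (2 * (1/2) ^ s)) \<longlonglongrightarrow> ennreal (2 * 0)"
        by (intro tendsto_ennrealI tendsto_mult tendsto_const LIMSEQ_power_zero) auto
      then have "eventually (\<lambda>s. ennreal (2 * (1/2) ^ s) < e) sequentially"
        using \<open>0 < e\<close> by (intro order_tendstoD(2)) auto
      then obtain s where "\<And>t. t \<ge> s \<Longrightarrow> ennreal (2 * (1/2) ^ t) < e" by (auto simp: eventually_sequentially)
      then show ?thesis by (intro that[of "max s k"]) auto
    qed
    have "(\<Sum>j. (\<Sum>s. ennreal (c s) * of_bool (N s \<le> j)) * f k l j) \<le>
        ennreal (2 * (1/2) ^ s0) + (\<Sum>s<s0. ennreal (c s) * (\<Sum>j. f k l j))" for l
    proof -
      have "(\<Sum>j. (\<Sum>s. ennreal (c s) * of_bool (N s \<le> j)) * f k l j) =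
          (\<Sum>j. \<Sum>s. ennreal (c s) * of_bool (N s \<le> j) * f k l j)" by simp
      also have "\<dots> = (\<Sum>s. ennreal (c s) * (\<Sum>j. f k l (j + N s)))"
        by (subst ennreal_suminf_swap) (simp add: ennreal_suminf_cut)
      also have "\<dots> = (\<Sum>s. ennreal (c (s + s0)) * (\<Sum>j. f k l (j + N (s + s0))))
           + (\<Sum>s<s0. ennreal (c s) * (\<Sum>j. f k l (j + N s)))"
        by (rule suminf_offset) auto
      also have "\<dots> \<le> (\<Sum>s. ennreal ((1/2) ^ (s + s0))) + (\<Sum>s<s0. ennreal (c s) * (\<Sum>j. f k l j))"
        using s0(1) by (intro add_mono suminf_le sum_mono mult_left_mono ennreal_suminf_tail_le N) auto
      finally show ?thesis by (simp only: ennreal_half_power_suminf)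
    qed
    moreover have "(\<lambda>l. ennreal (2 * (1/2) ^ s0) + (\<Sum>s<s0. ennreal (c s) * (\<Sum>j. f k l j)))
       \<longlonglongrightarrow> ennreal (2 * (1/2) ^ s0) + (\<Sum>s<s0. ennreal (c s) * 0)"
      by (intro tendsto_add tendsto_const tendsto_sum ennreal_tendsto_cmult lim) auto
    then have "eventually (\<lambda>l. ennreal (2 * (1/2) ^ s0) + (\<Sum>s<s0. ennreal (c s) * (\<Sum>j. f k l j)) < e) sequentially"
      using s0(2) by (intro order_tendstoD(2)) auto
    ultimately show "eventually (\<lambda>l. (\<Sum>j. (\<Sum>s. ennreal (c s) * of_bool (N s \<le> j)) * f k l j) < e) sequentially"
      by (auto elim!: eventually_mono intro: le_less_trans)
  qed simp
  with 2 show thesis by (rule that[rotated])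
qed

subsection \<open>Sequence spaces, shifts and lower density\<close>

text \<open>The \<open>p\<close>-th power of the norm, valued in [0, infinity], so that estimates
  need no prior summability.\<close>

definition psum :: "real \<Rightarrow> (nat \<Rightarrow> complex) \<Rightarrow> ennreal" where
  "psum p x = (\<Sum>i. ennreal (norm (x i) powr p))"

lemma psum_finite_iff: "psum p x < \<top> \<longleftrightarrow> x \<in> lp p"
proof
  assume "psum p x < \<top>"
  then show "x \<in> lp p" unfolding psum_def lp_def
    by (auto intro!: summable_suminf_not_top)
next
  assume "x \<in> lp p"
  then have "summable (\<lambda>n. norm (x n) powr p)" by (simp add: lp_def)
  then show "psum p x < \<top>" unfolding psum_def
    by (subst suminf_ennreal2) auto
qed

lemma lp_norm_less:
  assumes "p \<ge> 1" "e > 0" "psum p x < ennreal (e powr p)"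
  shows "lp_norm p x < e"
proof -
  have "x \<in> lp p" using assms(3) psum_finite_iff by (metis ennreal_less_top less_trans)
  then have s: "summable (\<lambda>n. norm (x n) powr p)" by (simp add: lp_def)
  have "psum p x = ennreal (\<Sum>n. norm (x n) powr p)" unfolding psum_def
    by (subst suminf_ennreal2) (use s in auto)
  with assms(3) have "(\<Sum>n. norm (x n) powr p) < e powr p"
    by (simp add: ennreal_less_iff suminf_nonneg s)
  then have "(\<Sum>n. norm (x n) powr p) powr (1/p) < (e powr p) powr (1/p)"
    using assms by (intro powr_less_mono2) (auto simp: suminf_nonneg s)
  also have "\<dots> = e" using assms by (simp add: powr_powr)
  finally show ?thesis by (simp add: lp_norm_def)
qed

text \<open>From \<open>norm (a + b) \<le> 2 * max (norm a) (norm b)\<close>; the constant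
  \<open>2 powr p\<close> is absorbed later by the choice of accuracy.\<close>

lemma norm_add_powr_le:
  fixes a b :: complex
  assumes "p \<ge> 0"
  shows "norm (a + b) powr p \<le> 2 powr p * (norm a powr p + norm b powr p)"
proof -
  have "norm (a + b) powr p \<le> (2 * max (norm a) (norm b)) powr p"
    using assms by (intro powr_mono2) (auto intro: order_trans[OF norm_triangle_ineq])
  also have "\<dots> = 2 powr p * (max (norm a) (norm b)) powr p" by (simp add: powr_mult)
  also have "\<dots> \<le> 2 powr p * (norm a powr p + norm b powr p)"
    by (intro mult_left_mono) (auto simp: max_def)
  finally show ?thesis .
qed

lemma psum_add_le:
  assumes "p \<ge> 0"
  shows "psum p (\<lambda>i. x i + y i) \<le> ennreal (2 powr p) * (psum p x + psum p y)"
proof -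
  have "psum p (\<lambda>i. x i + y i) \<le> (\<Sum>i. ennreal (2 powr p) * (ennreal (norm (x i) powr p) + ennreal (norm (y i) powr p)))"
    unfolding psum_def
    by (intro suminf_le)
      (auto simp flip: ennreal_plus ennreal_mult intro!: ennreal_leI norm_add_powr_le assms)
  also have "\<dots> = ennreal (2 powr p) * (psum p x + psum p y)"
    unfolding psum_def by (subst ennreal_suminf_cmult) (simp add: suminf_add)
  finally show ?thesis .
qed

lemma Wprod_Suc: "Wprod w (Suc n) = Wprod w n * w (Suc n)"
  by (simp add: Wprod_def)

lemma Wprod_nonzero: "is_weight w \<Longrightarrow> Wprod w n \<noteq> 0"
  by (auto simp: Wprod_def is_weight_def)

text \<open>The \<open>l\<close> weights with indices from \<open>i + 1\<close> to
  \<open>i + l\<close> are picked up; their product is a quotient of weight products because no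
  weight vanishes.\<close>

lemma bshift_funpow:
  assumes "is_weight w"
  shows "(bshift w ^^ l) x i = Wprod w (i + l) / Wprod w i * x (i + l)"
proof (induction l arbitrary: i)
  case (Suc l)
  have "w (Suc i) \<noteq> 0" using assms by (auto simp: is_weight_def)
  then show ?case using Wprod_nonzero[OF assms, of i]
    by (simp add: bshift_def[of w "(bshift w ^^ l) x"] Suc Wprod_Suc)
qed (simp add: Wprod_nonzero[OF assms])

lemma pos_lower_densityI:
  assumes "c > 0" "\<And>n. n \<ge> n0 \<Longrightarrow> c * real n \<le> real (card (A \<inter> {1..n}))"
  shows "pos_lower_density A"
proof -
  have "ereal c \<le> liminf (\<lambda>n. ereal (real (card (A \<inter> {1..n})) / real n))"
    using assms(2) by (intro Liminf_bounded eventually_sequentiallyI[of "max 1 n0"])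
      (auto simp: field_simps)
  with assms(1) show ?thesis unfolding pos_lower_density_def
    by (meson ereal_less(2) less_le_trans)
qed

text \<open>The \<open>n\<close> with \<open>multiplicity 2 n = s\<close> are the odd multiples of
  \<open>2 ^ s\<close>, one residue class modulo \<open>2 ^ Suc s\<close>.\<close>

lemma exists_multiplicity_in_window:
  "\<exists>n\<ge>a. n < a + 2 ^ Suc s \<and> multiplicity 2 n = s" for a s :: nat
proof -
  define q where "q = (2::nat) ^ Suc s"
  have q: "q > 0" "2 ^ s < q" by (auto simp: q_def)
  \<comment> \<open>The ceiling of \<open>(a - 2 ^ s) / q\<close>; since \<open>2 ^ s < q\<close>,
    the subtraction of naturals does not truncate.\<close>
  define b where "b = (a + q - 2 ^ s - 1) div q"
  define n where "n = 2 ^ s + q * b"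
  have "q * b \<le> a + q - 2 ^ s - 1" by (simp add: b_def)
  then have "n < a + q" using q unfolding n_def by linarith
  have "a + q - 2 ^ s - 1 < q * b + q" using dividend_less_times_div[of q "a + q - 2 ^ s - 1"] q
    by (simp add: b_def add.commute)
  then have "a \<le> n" using q unfolding n_def by linarith
  have "n = 2 ^ s * (1 + 2 * b)" by (simp add: n_def q_def algebra_simps)
  moreover have "\<not> 2 ^ Suc s dvd 2 ^ s * (1 + 2 * b)"
    unfolding power_Suc2 by (subst dvd_times_left_cancel_iff) auto
  ultimately have "multiplicity 2 n = s"
    by (intro multiplicity_eqI) auto
  with \<open>a \<le> n\<close> \<open>n < a + q\<close> show ?thesis by (auto simp: q_def)
qed

lemma card_multiples_ge:
  fixes a d :: nat
  assumes "d > 0"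
  shows "a div d \<le> card {l\<in>{a..2*a}. d dvd l}"
proof -
  have "(\<lambda>q. d * q) ` {a div d + 1..<a div d + 1 + a div d} \<subseteq> {l\<in>{a..2*a}. d dvd l}"
  proof (intro image_subsetI CollectI conjI)
    fix q assume q: "q \<in> {a div d + 1..<a div d + 1 + a div d}"
    have "a < d * (a div d) + d" using dividend_less_times_div[of d a] assms by simp
    also have "\<dots> = d * (a div d + 1)" by simp
    also have "\<dots> \<le> d * q" using q by (intro mult_le_mono) auto
    finally have "a \<le> d * q" by simp
    moreover have "d * q \<le> d * (2 * (a div d))" using q by (intro mult_le_mono) auto
    then have "d * q \<le> 2 * a" using times_div_less_eq_dividend[of d a] by linarith
    ultimately show "d * q \<in> {a..2*a}" by simp
  qed simp
  then have "card ((\<lambda>q. d * q) ` {a div d + 1..<a div d + 1 + a div d}) \<le> card {l\<in>{a..2*a}. d dvd l}"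
    by (intro card_mono) auto
  moreover have "inj_on (\<lambda>q. d * q) {a div d + 1..<a div d + 1 + a div d}"
    using assms by (auto simp: inj_on_def)
  ultimately show ?thesis by (simp add: card_image)
qed

subsection \<open>The vector built from geometric blocks\<close>

text \<open>The \<open>n\<close> with \<open>m ^ n \<le> j < m ^ (n + 1)\<close> when
  \<open>1 < m\<close> and \<open>0 < j\<close>; \<open>floorlog\<close> counts digits, hence the
  \<open>- 1\<close>. At \<open>j = 0\<close> the value is \<open>0\<close>.\<close>

definition block :: "nat \<Rightarrow> nat \<Rightarrow> nat" where
  "block m j = floorlog m j - 1"

lemma block_bounds:
  assumes "1 < m" "0 < j"
  shows "m ^ block m j \<le> j" "j < m ^ Suc (block m j)"
proof -
  have "floorlog m j > 0" using assms by (simp add: floorlog_def)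
  then show "m ^ block m j \<le> j" "j < m ^ Suc (block m j)"
    using floorlog_bounds[of j m] assms by (auto simp: block_def)
qed

lemma block_eqI:
  assumes "1 < m" "m ^ n \<le> j" "j < m ^ Suc n"
  shows "block m j = n"
proof -
  have j: "0 < j" using assms by (intro gr0I) auto
  have "m ^ block m j < m ^ Suc n" "m ^ n < m ^ Suc (block m j)"
    using block_bounds[OF assms(1) j] assms by linarith+
  then show ?thesis using assms(1) by (simp add: power_strict_increasing_iff del: power_Suc)
qed

lemma block_at_top:
  assumes "1 < m"
  shows "filterlim (block m) at_top sequentially"
  unfolding filterlim_at_top
proof
  fix n
  have "n \<le> block m j" if "j \<ge> m ^ n" for j
  proof -
    have "0 < m ^ n" using assms by simp
    then have "0 < j" using that by linarith
    then have "m ^ n < m ^ Suc (block m j)" using block_bounds[OF assms, of j] that by linarith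
    then show ?thesis using assms by (simp add: power_strict_increasing_iff del: power_Suc)
  qed
  then show "eventually (\<lambda>j. n \<le> block m j) sequentially" by (rule eventually_sequentiallyI)
qed

text \<open>A common lower bound for the weight products of all members, for estimating coordinates
  whose block serves another weight.\<close>

definition inf_Wprod :: "(nat \<Rightarrow> nat \<Rightarrow> complex) \<Rightarrow> nat \<Rightarrow> real" where
  "inf_Wprod w j = (INF i\<in>{1..}. norm (Wprod (w i) j))"

text \<open>The terms of the tail series in \<open>Rterm\<close>, extended by \<open>0\<close> to all indices; the power of \<open>m\<close> is the one with
  \<open>m ^ n \<le> l < m ^ (n + 1)\<close>.\<close>

definition cross :: "(nat \<Rightarrow> nat \<Rightarrow> complex) \<Rightarrow> real \<Rightarrow> nat \<Rightarrow> nat \<Rightarrow> nat \<Rightarrow> nat \<Rightarrow> ennreal" where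
  "cross w p m k l j =
     (if 1 \<le> k \<and> 1 \<le> block m l \<and> l \<le> 2 * m ^ block m l \<and> m ^ Suc (block m l) \<le> j
      then ennreal (norm (Wprod (w k) j / (Wprod (w k) (j - l) * inf_Wprod w j)) powr p) else 0)"

text \<open>Lists encode finitely supported vectors, so that entries from a countable set
  \<open>Q\<close> give the countable set \<open>lists Q\<close>.\<close>

definition fin_vec :: "complex list \<Rightarrow> nat \<Rightarrow> complex" where
  "fin_vec y i = (if i < length y then y ! i else 0)"

lemma inf_Wprod_le: "1 \<le> k \<Longrightarrow> inf_Wprod w j \<le> norm (Wprod (w k) j)"
  unfolding inf_Wprod_def by (rule cINF_lower) (auto intro!: bdd_belowI[of _ 0])

text \<open>After \<open>l\<close> shifts there are three ranges of \<open>i\<close>: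
  \<open>i < D s\<close>, where the error is zero; \<open>i \<ge> D s\<close> with
  \<open>i + l\<close> in block \<open>n\<close>, controlled by a tail of \<open>h s\<close>; and
  \<open>i + l\<close> in later blocks, controlled by \<open>cross\<close>. The last two get
  \<open>\<delta> s / 2\<close> each.\<close>

lemma exists_block_vector:
  fixes w :: "nat \<Rightarrow> nat \<Rightarrow> complex" and \<kappa> :: "nat \<Rightarrow> nat" and y :: "nat \<Rightarrow> complex list" and \<delta> :: "nat \<Rightarrow> real"
  assumes p: "1 \<le> p" and m: "2 < m"
    and weights: "\<And>k. 1 \<le> k \<Longrightarrow> is_weight (w k)"
    and inf_pos: "\<And>j. inf_Wprod w j > 0"
    and inv_fin: "\<And>k. 1 \<le> k \<Longrightarrow> psum p (\<lambda>j. 1 / Wprod (w k) j) < \<top>"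
    and cross_fin: "\<And>k l. (\<Sum>j. cross w p m k l j) < \<top>"
    and cross_lim: "\<And>k. (\<lambda>l. \<Sum>j. cross w p m k l j) \<longlonglongrightarrow> 0"
    and \<kappa>: "\<And>s. 1 \<le> \<kappa> s" and \<delta>: "\<And>s. 0 < \<delta> s"
  shows "\<exists>x\<in>lp p. \<forall>s. \<exists>D>0. \<exists>n0. \<forall>n\<ge>n0. multiplicity 2 n = s \<longrightarrow>
    (\<forall>l\<in>{m^n..2*m^n}. D dvd l \<longrightarrow>
       psum p (\<lambda>i. (bshift (w (\<kappa> s)) ^^ l) x i - fin_vec (y s) i) \<le> ennreal (\<delta> s))"
proof -
  define W where "W s j = Wprod (w (\<kappa> s)) j" for s j
  \<comment> \<open>The factor \<open>W s i\<close> cancels the division by \<open>W s i\<close>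
    that the shift leaves behind; \<open>c s\<close> bounds all entries of \<open>u s\<close> at
    once.\<close>
  define u where "u s i = fin_vec (y s) i * W s i" for s i
  define c where "c s = (\<Sum>i<length (y s). norm (u s i) powr p)" for s
  define h where "h s j = ennreal (norm (1 / W s j) powr p)" for s j
  \<comment> \<open>The block \<open>[m ^ n, m ^ (n + 1))\<close> serves the single target \<open>multiplicity 2 n\<close>, which recurs with bounded gaps.\<close>
  define ix where "ix j = (multiplicity 2 (block m j) :: nat)" for j
  have W0: "W s j \<noteq> 0" for s j unfolding W_def by (intro Wprod_nonzero weights \<kappa>)
  have c: "norm (u s i) powr p \<le> c s" for s i
  proof (cases "i < length (y s)")
    case True
    then show ?thesis unfolding c_def
      by (intro member_le_sum[of i _ "\<lambda>i. norm (u s i) powr p"]) auto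
  qed (auto simp: u_def fin_vec_def c_def sum_nonneg)
  have h_fin: "(\<Sum>j. h s j) < \<top>" for s
    using inv_fin[OF \<kappa>, of s] by (simp add: h_def W_def psum_def)
  \<comment> \<open>The first property controls the later blocks, whatever targets they serve; the
    second puts \<open>x\<close> into \<open>lp p\<close>.\<close>
  obtain N where N1: "\<And>k. (\<lambda>l. \<Sum>j. (\<Sum>s. ennreal (c s) * of_bool (N s \<le> j)) * cross w p m k l j) \<longlonglongrightarrow> 0"
    and N2: "(\<Sum>j. \<Sum>s. ennreal (c s) * of_bool (N s \<le> j) * h s j) < \<top>"
    using slow_activation[of "cross w p m" h c] cross_fin cross_lim h_fin by blast
  have "\<exists>D. 0 < D \<and> length (y s) \<le> D \<and> ennreal (c s) * (\<Sum>i. h s (i + D)) < ennreal (\<delta> s / 2)" for s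
  proof -
    have "(\<lambda>D. ennreal (c s) * (\<Sum>i. h s (i + D))) \<longlonglongrightarrow> ennreal (c s) * 0"
      by (intro ennreal_tendsto_cmult ennreal_suminf_tail_tendsto_0 h_fin) auto
    then have "eventually (\<lambda>D. ennreal (c s) * (\<Sum>i. h s (i + D)) < ennreal (\<delta> s / 2)) sequentially"
      using \<delta>[of s] by (intro order_tendstoD(2)) auto
    then obtain D0 where "\<And>D. D \<ge> D0 \<Longrightarrow> ennreal (c s) * (\<Sum>i. h s (i + D)) < ennreal (\<delta> s / 2)"
      by (auto simp: eventually_sequentially)
    then show ?thesis by (intro exI[of _ "max D0 (max 1 (length (y s)))"]) auto
  qed
  then obtain D where D: "\<And>s. 0 < D s" "\<And>s. length (y s) \<le> D s"
      "\<And>s. ennreal (c s) * (\<Sum>i. h s (i + D s)) < ennreal (\<delta> s / 2)"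
    by metis
  \<comment> \<open>The threshold is compared with the start of the block, so a block is filled
    entirely or not at all. The test \<open>0 < j\<close> secures
    \<open>m ^ block m j \<le> j\<close>.\<close>
  define x where "x j = (if 0 < j \<and> N (ix j) \<le> m ^ block m j
      then u (ix j) (j mod D (ix j)) / W (ix j) j else 0)" for j
  have act: "0 < j" "N (ix j) \<le> j" if "x j \<noteq> 0" for j
    using that block_bounds(1)[of m j] m by (auto simp: x_def split: if_splits)
  have x_eq: "x j = u (ix j) (j mod D (ix j)) / W (ix j) j" if "x j \<noteq> 0" for j
    using that by (auto simp: x_def split: if_splits)
  have single: "F s \<le> (\<Sum>s. F s)" for s and F :: "nat \<Rightarrow> ennreal"
    using sum_le_suminf[of F "{s}"] by simp
  \<comment> \<open>Coordinate \<open>j\<close> is charged to its own target \<open>ix j\<close>, a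
    single term of the sum over \<open>s\<close>.\<close>
  have "psum p x \<le> (\<Sum>j. \<Sum>s. ennreal (c s) * of_bool (N s \<le> j) * h s j)"
    unfolding psum_def
  proof (intro suminf_le)
    fix j
    show "ennreal (norm (x j) powr p) \<le> (\<Sum>s. ennreal (c s) * of_bool (N s \<le> j) * h s j)"
    proof (cases "x j = 0")
      case False
      define s where "s = ix j"
      have "norm (x j) powr p = norm (u s (j mod D s)) powr p * norm (1 / W s j) powr p"
        unfolding x_eq[OF False] s_def by (simp add: norm_divide powr_divide)
      also have "\<dots> \<le> c s * norm (1 / W s j) powr p" by (intro mult_right_mono c) auto
      finally have "ennreal (norm (x j) powr p) \<le> ennreal (c s) * of_bool (N s \<le> j) * h s j"
        using act(2)[OF False] by (simp add: h_def s_def ennreal_leI flip: ennreal_mult'')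
      also have "\<dots> \<le> (\<Sum>s. ennreal (c s) * of_bool (N s \<le> j) * h s j)" by (rule single)
      finally show ?thesis .
    qed simp
  qed auto
  with N2 have x_lp: "x \<in> lp p" by (subst psum_finite_iff[symmetric]) (rule le_less_trans)
  define g where "g j = (\<Sum>s. ennreal (c s) * of_bool (N s \<le> j))" for j
  have "\<exists>n0. \<forall>n\<ge>n0. multiplicity 2 n = s \<longrightarrow>
    (\<forall>l\<in>{m^n..2*m^n}. D s dvd l \<longrightarrow>
       psum p (\<lambda>i. (bshift (w (\<kappa> s)) ^^ l) x i - fin_vec (y s) i) \<le> ennreal (\<delta> s))" for s
  proof -
    have "eventually (\<lambda>l. (\<Sum>j. g j * cross w p m (\<kappa> s) l j) < ennreal (\<delta> s / 2)) sequentially"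
      unfolding g_def using \<delta>[of s] by (intro order_tendstoD(2)[OF N1]) auto
    then obtain L where L: "\<And>l. l \<ge> L \<Longrightarrow> (\<Sum>j. g j * cross w p m (\<kappa> s) l j) < ennreal (\<delta> s / 2)"
      by (auto simp: eventually_sequentially)
    \<comment> \<open>Since \<open>n < m ^ n\<close>, all thresholds lie below \<open>m ^ n\<close>;
      the \<open>1\<close> makes \<open>block m l\<close> positive, as \<open>cross\<close>
      demands.\<close>
    define n0 where "n0 = 1 + L + N s + D s"
    show ?thesis
    proof (intro exI[of _ n0] allI impI ballI)
      fix n l assume n: "n \<ge> n0" "multiplicity 2 n = s" and l: "l \<in> {m^n..2*m^n}" and dvd: "D s dvd l"
      have nm: "n < m ^ n" using m by (intro power_gt_expt) auto
      \<comment> \<open>Here \<open>m \<ge> 3\<close> enters: \<open>l\<close> stays in block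
        \<open>n\<close>, and \<open>i + l\<close> leaves it only for
        \<open>i \<ge> m ^ n \<ge> D s\<close>.\<close>
      have l3: "l + m ^ n \<le> m ^ Suc n"
      proof -
        have "l + m ^ n \<le> 3 * m ^ n" using l by simp
        also have "\<dots> \<le> m * m ^ n" using m by (intro mult_right_mono) auto
        finally show ?thesis by simp
      qed
      have big: "L \<le> l" "N s \<le> m ^ n" "D s \<le> m ^ n" "0 < l" "1 \<le> n"
        using n(1) nm l by (auto simp: n0_def)
      have bl: "block m l = n" using m l l3 big nm by (intro block_eqI) auto
      have sh: "(bshift (w (\<kappa> s)) ^^ l) x i = W s (i + l) / W s i * x (i + l)" for i
        unfolding W_def by (intro bshift_funpow weights \<kappa>)
      define d where "d i = (bshift (w (\<kappa> s)) ^^ l) x i - fin_vec (y s) i" for i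
      have "ennreal (norm (d i) powr p) \<le>
          ennreal (c s) * of_bool (D s \<le> i) * h s i + g (i + l) * cross w p m (\<kappa> s) l (i + l)" for i
      proof (cases "i + l < m ^ Suc n")
        case True
        then have "block m (i + l) = n" using m l by (intro block_eqI) auto
        then have ix: "ix (i + l) = s" using n(2) by (simp add: ix_def)
        \<comment> \<open>Shifting by a multiple of the period keeps the phase.\<close>
        have "(i + l) mod D s = i mod D s" using dvd by (auto elim!: dvdE)
        then have "x (i + l) = u s (i mod D s) / W s (i + l)"
          unfolding x_def using ix big \<open>block m (i + l) = n\<close> by simp
        then have eq: "d i = u s (i mod D s) / W s i - fin_vec (y s) i"
          unfolding d_def sh using W0[of s "i + l"] by simp
        show ?thesis
        proof (cases "i < D s")
          case True
          then have "d i = 0" unfolding eq using W0[of s i] by (simp add: u_def)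
          then show ?thesis by simp
        next
          case False
          then have "d i = u s (i mod D s) / W s i" unfolding eq using D(2)[of s] by (simp add: fin_vec_def)
          then have "norm (d i) powr p = norm (u s (i mod D s)) powr p * norm (1 / W s i) powr p"
            by (simp add: norm_divide powr_divide)
          also have "\<dots> \<le> c s * norm (1 / W s i) powr p" by (intro mult_right_mono c) auto
          finally have "ennreal (norm (d i) powr p) \<le> ennreal (c s) * of_bool (D s \<le> i) * h s i"
            using False by (simp add: h_def ennreal_leI flip: ennreal_mult'')
          then show ?thesis by (meson add_increasing2 zero_le order_trans le_add_same_cancel1)
        qed
      next
        case False
        define j where "j = i + l"
        have "i \<ge> D s" using False l3 big by linarith
        then have deq: "d i = W s j / W s (j - l) * x j"
          unfolding d_def sh j_def using D(2)[of s] by (simp add: fin_vec_def)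
        show ?thesis
        proof (cases "x j = 0")
          case True
          then show ?thesis using deq by simp
        next
          case nz: False
          define t where "t = ix j"
          have "norm (d i) powr p = norm (u t (j mod D t)) powr p * norm (W s j / (W s (j - l) * W t j)) powr p"
            unfolding deq x_eq[OF nz] t_def by (simp add: norm_divide norm_mult powr_divide powr_mult)
          \<comment> \<open>The target \<open>t\<close> at coordinate \<open>j\<close> may belong to
            another weight, so its weight product is replaced by the infimum over all
            weights.\<close>
          also have "\<dots> \<le> c t * norm (W s j / (W s (j - l) * inf_Wprod w j)) powr p"
          proof (intro mult_mono c powr_mono2)
            show "norm (W s j / (W s (j - l) * W t j)) \<le> norm (W s j / (W s (j - l) * inf_Wprod w j))"
              using inf_pos[of j] inf_Wprod_le[OF \<kappa>, of w j t] W0[of s "j - l"]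
              unfolding norm_divide norm_mult
              by (intro divide_left_mono mult_left_mono mult_pos_pos) (auto simp: W_def)
          qed (use p c in \<open>auto simp: c_def intro: sum_nonneg\<close>)
          finally have "ennreal (norm (d i) powr p) \<le> ennreal (c t) * of_bool (N t \<le> j) * cross w p m (\<kappa> s) l j"
            using act(2)[OF nz] False \<kappa>[of s] bl l big
            by (auto simp: cross_def j_def t_def W_def ennreal_leI simp flip: ennreal_mult'')
          also have "\<dots> \<le> g j * cross w p m (\<kappa> s) l j"
            unfolding g_def by (intro mult_right_mono single) auto
          finally show ?thesis unfolding j_def
            by (meson add_increasing zero_le)
        qed
      qed
      then have "psum p d \<le> (\<Sum>i. ennreal (c s) * of_bool (D s \<le> i) * h s i + g (i + l) * cross w p m (\<kappa> s) l (i + l))"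
        unfolding psum_def by (intro suminf_le) auto
      also have "\<dots> = ennreal (c s) * (\<Sum>i. h s (i + D s)) + (\<Sum>i. g (i + l) * cross w p m (\<kappa> s) l (i + l))"
        by (subst suminf_add[symmetric]) (auto simp: ennreal_suminf_cut)
      also have "\<dots> \<le> ennreal (\<delta> s / 2) + ennreal (\<delta> s / 2)"
      proof (rule add_mono)
        have "(\<Sum>i. g (i + l) * cross w p m (\<kappa> s) l (i + l)) \<le> (\<Sum>i. g i * cross w p m (\<kappa> s) l i)"
          by (rule ennreal_suminf_tail_le)
        also have "\<dots> < ennreal (\<delta> s / 2)" using big by (intro L)
        finally show "(\<Sum>i. g (i + l) * cross w p m (\<kappa> s) l (i + l)) \<le> ennreal (\<delta> s / 2)" by simp
      qed (use D(3)[of s] in simp)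
      also have "\<dots> = ennreal (\<delta> s)" using \<delta>[of s] by (simp flip: ennreal_plus)
      finally show "psum p (\<lambda>i. (bshift (w (\<kappa> s)) ^^ l) x i - fin_vec (y s) i) \<le> ennreal (\<delta> s)"
        by (simp add: d_def[abs_def])
    qed
  qed
  note hits = this
  show ?thesis
    by (intro bexI[OF _ x_lp] allI, rule_tac x = "D s" in exI, intro conjI D hits)
qed

section \<open>Lower density of the hitting times\<close>

text \<open>For large \<open>N\<close> in block \<open>b\<close>, some \<open>n < b\<close> of the
  right multiplicity has \<open>b - n \<le> g\<close>. Its window lies below \<open>N\<close> and
  holds about \<open>m ^ n / d\<close> multiples of \<open>d\<close>, while
  \<open>N \<le> m ^ Suc g * m ^ n\<close>.\<close>

lemma pos_lower_density_blocks:
  assumes m: "1 < m" and d: "0 < d"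
    and A: "\<And>n. n0 \<le> n \<Longrightarrow> multiplicity 2 n = s \<Longrightarrow> {l\<in>{m^n..2*m^n}. d dvd l} \<subseteq> A"
  shows "pos_lower_density A"
proof -
  define g where "g = (2::nat) ^ Suc s"
  \<comment> \<open>Large enough for \<open>b - g\<close> not to truncate, for
    \<open>n0 \<le> n\<close>, and for \<open>d \<le> n < m ^ n\<close>.\<close>
  define b0 where "b0 = n0 + d + g"
  \<comment> \<open>The \<open>2\<close> pays for rounding in \<open>m ^ n div d\<close>, the power
    of \<open>m\<close> for the ratio of \<open>N\<close> to \<open>m ^ n\<close>.\<close>
  define c where "c = 1 / (2 * real d * real m ^ Suc g)"
  show ?thesis
  proof (rule pos_lower_densityI)
    show "0 < c" using m d by (simp add: c_def)
    fix N assume N: "m ^ b0 \<le> N"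
    define b where "b = block m N"
    have "0 < m ^ b0" using m by simp
    then have "0 < N" using N by linarith
    then have b: "m ^ b \<le> N" "N < m ^ Suc b" using block_bounds[OF m, of N] by (auto simp: b_def)
    have "m ^ b0 < m ^ Suc b" using N b(2) by linarith
    then have "b0 \<le> b" using m by (simp add: power_strict_increasing_iff del: power_Suc)
    obtain n where n: "b - g \<le> n" "n < b - g + g" "multiplicity 2 n = s"
      using exists_multiplicity_in_window[of "b - g" s] by (auto simp: g_def)
    have n2: "n0 \<le> n" "d \<le> n" "n < b" "b \<le> n + g" using n \<open>b0 \<le> b\<close> by (auto simp: b0_def)
    have "n < m ^ n" using m by (intro power_gt_expt) auto
    then have dm: "d \<le> m ^ n" using n2 by linarith
    have "2 * m ^ n \<le> m * m ^ n" using m by (intro mult_right_mono) auto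
    also have "\<dots> = m ^ Suc n" by simp
    also have "\<dots> \<le> m ^ b" using m n2 by (intro power_increasing) auto
    finally have top: "2 * m ^ n \<le> N" using b by linarith
    have "m ^ n div d \<le> card {l\<in>{m^n..2*m^n}. d dvd l}" by (rule card_multiples_ge[OF d])
    also have "\<dots> \<le> card (A \<inter> {1..N})"
    proof (intro card_mono subsetI)
      fix l assume l: "l \<in> {l\<in>{m^n..2*m^n}. d dvd l}"
      have "0 < l" using l m by (intro gr0I) auto
      with l top have "l \<in> {1..N}" by auto
      moreover have "l \<in> A" using A[OF n2(1) n(3)] l by (rule subsetD)
      ultimately show "l \<in> A \<inter> {1..N}" by blast
    qed auto
    finally have card: "m ^ n div d \<le> card (A \<inter> {1..N})" .
    have "1 \<le> m ^ n div d" using dm d by (simp add: div_greater_zero_iff Suc_le_eq)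
    then have "d * 1 \<le> d * (m ^ n div d)" by (intro mult_le_mono) auto
    moreover have "m ^ n < d * (m ^ n div d) + d" using dividend_less_times_div[OF d, of "m ^ n"] by simp
    ultimately have "m ^ n \<le> 2 * d * (m ^ n div d)" by linarith
    also have "\<dots> \<le> 2 * d * card (A \<inter> {1..N})" using card by (intro mult_le_mono) auto
    finally have 1: "m ^ n \<le> 2 * d * card (A \<inter> {1..N})" .
    have "N \<le> m ^ Suc b" using b by simp
    also have "\<dots> \<le> m ^ (Suc g + n)" using m n2 by (intro power_increasing) auto
    also have "\<dots> = m ^ Suc g * m ^ n" by (rule power_add)
    also have "\<dots> \<le> m ^ Suc g * (2 * d * card (A \<inter> {1..N}))" using 1 by (intro mult_le_mono) auto
    finally have "real N \<le> real (m ^ Suc g * (2 * d * card (A \<inter> {1..N})))" by (rule of_nat_mono)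
    then show "c * real N \<le> real (card (A \<inter> {1..N}))"
      using m d by (simp add: c_def field_simps)
  qed
qed

section \<open>Approximation by finitely supported vectors\<close>

text \<open>Truncate a point of \<open>U\<close> and move its remaining coordinates into the dense
  set \<open>Q\<close>. Here \<open>z\<close> ranges over all sequences; the finite bound itself
  brings \<open>z\<close> into \<open>lp p\<close>.\<close>

lemma lp_open_contains_fin_vec_ball:
  assumes p: "1 \<le> p" and U: "lp_open p U" "U \<noteq> {}"
    and Q: "\<And>X::complex set. open X \<Longrightarrow> X \<noteq> {} \<Longrightarrow> \<exists>q\<in>Q. q \<in> X"
  shows "\<exists>y\<in>lists Q. \<exists>t::nat. \<forall>z. psum p (\<lambda>i. z i - fin_vec y i) \<le> ennreal (1 / Suc t) \<longrightarrow> z \<in> U"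
proof -
  obtain v where v: "v \<in> U" using U by auto
  with U obtain e where v_lp: "v \<in> lp p" and e: "e > 0" "\<And>z. z \<in> lp p \<Longrightarrow> lp_norm p (z - v) < e \<Longrightarrow> z \<in> U"
    unfolding lp_open_def by blast
  \<comment> \<open>Two errors of size \<open>\<eta>\<close> combine to
    \<open>2 powr p * (\<eta> + \<eta>)\<close>, two thirds of \<open>e powr p\<close>.\<close>
  define \<eta> where "\<eta> = e powr p / (2 powr p * 3)"
  have \<eta>: "\<eta> > 0" using e by (simp add: \<eta>_def)
  have v_fin: "psum p v < \<top>" using v_lp by (simp add: psum_finite_iff)
  have "eventually (\<lambda>n. (\<Sum>i. ennreal (norm (v (i + n)) powr p)) < ennreal (\<eta> / 2)) sequentially"
    using \<eta> v_fin by (intro order_tendstoD(2)[OF ennreal_suminf_tail_tendsto_0]) (auto simp: psum_def)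
  then obtain n where n: "(\<Sum>i. ennreal (norm (v (i + n)) powr p)) < ennreal (\<eta> / 2)"
    by (auto simp: eventually_sequentially)
  \<comment> \<open>Makes the \<open>n\<close> coordinate errors add up to at most
    \<open>\<eta> / 2\<close>; \<open>Suc n\<close> avoids division by zero.\<close>
  define r where "r = (\<eta> / (2 * Suc n)) powr (1 / p)"
  have "r > 0" using \<eta> by (simp add: r_def)
  then have "\<exists>q\<in>Q. q \<in> ball (v i) r" for i by (intro Q) auto
  then obtain q where q: "\<And>i. q i \<in> Q" "\<And>i. q i \<in> ball (v i) r" by metis
  define y where "y = map q [0..<n]"
  have y: "fin_vec y i = (if i < n then q i else 0)" for i by (simp add: y_def fin_vec_def)
  have q_le: "norm (q i - v i) powr p \<le> \<eta> / (2 * Suc n)" for i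
  proof -
    have "norm (q i - v i) powr p \<le> r powr p"
      using q(2)[of i] p by (intro powr_mono2) (auto simp: dist_norm norm_minus_commute)
    also have "\<dots> = \<eta> / (2 * Suc n)" using p \<eta> by (simp add: r_def powr_powr)
    finally show ?thesis .
  qed
  have "psum p (\<lambda>i. fin_vec y i - v i) =
      (\<Sum>i. ennreal (norm (v (i + n)) powr p)) + (\<Sum>i<n. ennreal (norm (q i - v i) powr p))"
    unfolding psum_def by (subst suminf_offset[of _ n]) (auto simp: y)
  also have "\<dots> \<le> ennreal (\<eta> / 2) + (\<Sum>i<n. ennreal (\<eta> / (2 * Suc n)))"
    using n by (intro add_mono sum_mono ennreal_leI q_le) auto
  also have "\<dots> \<le> ennreal \<eta>"
  proof -
    have "(\<Sum>i<n. ennreal (\<eta> / (2 * Suc n))) = ennreal (\<Sum>i<n. \<eta> / (2 * Suc n))"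
      using \<eta> by (intro sum_ennreal) auto
    also have "\<dots> \<le> ennreal (\<eta> / 2)" using \<eta> by (intro ennreal_leI) (auto simp: field_simps)
    finally have "ennreal (\<eta> / 2) + (\<Sum>i<n. ennreal (\<eta> / (2 * Suc n))) \<le> ennreal (\<eta> / 2) + ennreal (\<eta> / 2)"
      by (intro add_mono) auto
    also have "\<dots> = ennreal \<eta>" using \<eta> by (simp flip: ennreal_plus)
    finally show ?thesis .
  qed
  finally have yv: "psum p (\<lambda>i. fin_vec y i - v i) \<le> ennreal \<eta>" .
  obtain t :: nat where t: "1 / Suc t < \<eta>" using nat_approx_posE[OF \<eta>] .
  have "z \<in> U" if z: "psum p (\<lambda>i. z i - fin_vec y i) \<le> ennreal (1 / Suc t)" for z
  proof -
    have "psum p (\<lambda>i. z i - v i) = psum p (\<lambda>i. (z i - fin_vec y i) + (fin_vec y i - v i))" by simp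
    also have "\<dots> \<le> ennreal (2 powr p) * (psum p (\<lambda>i. z i - fin_vec y i) + psum p (\<lambda>i. fin_vec y i - v i))"
      using p by (intro psum_add_le) auto
    also have "\<dots> \<le> ennreal (2 powr p) * (ennreal (1 / Suc t) + ennreal \<eta>)"
      by (intro mult_left_mono add_mono z yv) auto
    also have "\<dots> \<le> ennreal (2 powr p) * (ennreal \<eta> + ennreal \<eta>)"
      using t by (intro mult_left_mono add_mono ennreal_leI) auto
    also have "\<dots> = ennreal (2 powr p * (\<eta> + \<eta>))" using \<eta> by (simp add: ennreal_mult' del: ennreal_plus flip: ennreal_plus)
    also have "\<dots> < ennreal (e powr p)"
      using e by (intro ennreal_lessI) (auto simp: \<eta>_def field_simps)
    finally have lt: "psum p (z - v) < ennreal (e powr p)" by (simp add: fun_diff_def)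
    have "psum p z = psum p (\<lambda>i. (z - v) i + v i)" by simp
    also have "\<dots> \<le> ennreal (2 powr p) * (psum p (z - v) + psum p v)"
      using p psum_add_le[of p "z - v" v] by simp
    also have "\<dots> < \<top>"
      using v_fin less_trans[OF lt ennreal_less_top] by (simp add: ennreal_mult_less_top)
    finally have "z \<in> lp p" by (simp add: psum_finite_iff)
    then show "z \<in> U" using lp_norm_less[OF p e(1) lt] e(2) by blast
  qed
  moreover have "y \<in> lists Q" using q(1) by (auto simp: y_def)
  ultimately show ?thesis by blast
qed

section \<open>Summability consequences of the hypotheses on the weights\<close>

text \<open>Cauchy condensation: the terms at \<open>2 ^ n\<close>, times \<open>2 ^ n\<close>, are
  at most a constant times \<open>real n powr (-a)\<close> for \<open>n \<ge> 1\<close>.\<close>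

lemma summable_inverse_mult_ln_powr:
  fixes a :: real
  assumes "a > 1"
  shows "summable (\<lambda>n. 1 / real n * ln (real n + 1) powr (-a))"
proof -
  have "summable (\<lambda>n. 2 ^ n * (1 / real (2 ^ n) * ln (real (2 ^ n) + 1) powr (-a)))"
  proof (rule summable_comparison_test_ev)
    show "eventually (\<lambda>n. norm (2 ^ n * (1 / real (2 ^ n) * ln (real (2 ^ n) + 1) powr (-a)))
        \<le> ln 2 powr (-a) * real n powr (-a)) sequentially"
    proof (rule eventually_sequentiallyI[of 1])
      fix n :: nat assume "1 \<le> n"
      have "real n * ln 2 = ln (2 ^ n)" by (simp add: ln_realpow)
      also have "\<dots> \<le> ln (2 ^ n + 1)" by (subst ln_le_cancel_iff) (auto intro: add_pos_pos)
      finally have "ln (2 ^ n + 1) powr (-a) \<le> (real n * ln 2) powr (-a)"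
        using assms \<open>1 \<le> n\<close> by (intro powr_mono2') auto
      then show "norm (2 ^ n * (1 / real (2 ^ n) * ln (real (2 ^ n) + 1) powr (-a)))
        \<le> ln 2 powr (-a) * real n powr (-a)"
        using \<open>1 \<le> n\<close> by (simp add: powr_mult mult.commute[of "ln 2 powr _"])
    qed
    show "summable (\<lambda>n. ln 2 powr (-a) * real n powr (-a))"
      using assms by (intro summable_mult) (simp add: summable_real_powr_iff)
  qed
  then show ?thesis
  proof (subst condensation_test)
    fix n :: nat assume "0 < n"
    then show "1 / real (Suc n) * ln (real (Suc n) + 1) powr (-a) \<le> 1 / real n * ln (real n + 1) powr (-a)"
      using assms by (intro mult_mono powr_mono2' frac_le) auto
  qed auto
qed

text \<open>The logarithm carries the exponent \<open>1 + p / 2 + \<tau> > 1\<close>, so the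
  majorant is summable.\<close>

lemma psum_inverse_Wprod_finite:
  assumes p: "1 \<le> p" and C: "\<tau> > 0"
    and growth: "\<And>n. n \<ge> 1 \<Longrightarrow> norm (Wprod w n) powr (-p) \<le> C * (1 / real n) * ln (real n + 1) powr (-(1 + p / 2 + \<tau>))"
  shows "psum p (\<lambda>j. 1 / Wprod w j) < \<top>"
proof -
  have "summable (\<lambda>n. C * (1 / real n * ln (real n + 1) powr (-(1 + p / 2 + \<tau>))))"
    using p C by (intro summable_mult summable_inverse_mult_ln_powr) auto
  moreover have "eventually (\<lambda>n. norm (norm (1 / Wprod w n) powr p) \<le>
      C * (1 / real n * ln (real n + 1) powr (-(1 + p / 2 + \<tau>)))) sequentially"
  proof (rule eventually_sequentiallyI[of 1])
    fix n :: nat assume "1 \<le> n"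
    then show "norm (norm (1 / Wprod w n) powr p) \<le> C * (1 / real n * ln (real n + 1) powr (-(1 + p / 2 + \<tau>)))"
      using growth[of n] by (simp add: norm_divide powr_divide powr_minus_divide mult.assoc)
  qed
  ultimately have "summable (\<lambda>n. norm (1 / Wprod w n) powr p)"
    by (rule summable_comparison_test_ev[rotated])
  then show ?thesis by (simp add: psum_finite_iff lp_def)
qed

text \<open>\<open>cross\<close> is zero before \<open>m ^ Suc (block m l)\<close>, where the tail
  series of \<open>Rterm\<close> starts, and the finite sum in \<open>Rterm\<close> is
  nonnegative.\<close>

lemma suminf_cross_le_Rterm:
  assumes "1 \<le> block m l" "l \<le> 2 * m ^ block m l"
  shows "(\<Sum>j. cross w p m k l j) \<le> Rterm w \<alpha> p m (block m l) k l"
proof -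
  have "(\<Sum>j. cross w p m k l j) = (\<Sum>j. cross w p m k l (j + m ^ Suc (block m l)))"
    by (subst suminf_offset[of _ "m ^ Suc (block m l)"]) (auto simp: cross_def)
  also have "\<dots> \<le> Rterm w \<alpha> p m (block m l) k l"
    unfolding Rterm_def by (intro add_increasing suminf_le) (auto simp: cross_def inf_Wprod_def)
  finally show ?thesis .
qed

text \<open>The terms of a convergent series tend to zero; here they are suprema over windows,
  \<open>block m l\<close> tends to infinity, and \<open>cross\<close> vanishes outside the windows
  and for \<open>k = 0\<close>.\<close>

lemma cross_lim:
  assumes m: "1 < m"
    and gm: "2 \<le> \<gamma>" 
    and Rsum: "1 \<le> k \<Longrightarrow> (\<Sum>n. (SUP l\<in>{m ^ (Suc n) .. \<gamma> * m ^ (Suc n)}. Rterm w \<alpha> p m (Suc n) k l)) < \<top>"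
  shows "(\<Sum>j. cross w p m k l j) < \<top>" "(\<lambda>l. \<Sum>j. cross w p m k l j) \<longlonglongrightarrow> 0"
proof -
  define R where "R n = (SUP l\<in>{m ^ (Suc n) .. \<gamma> * m ^ (Suc n)}. Rterm w \<alpha> p m (Suc n) k l)" for n
  \<comment> \<open>The series starts at exponent 1, so block \<open>Suc n\<close> belongs to
    \<open>R n\<close>; when \<open>block m l = 0\<close> the left side is zero.\<close>
  have le: "(\<Sum>j. cross w p m k l j) \<le> R (block m l - 1)" for l
  proof (cases "1 \<le> block m l \<and> l \<le> 2 * m ^ block m l")
    case True
    then obtain n where n: "block m l = Suc n" by (cases "block m l") auto
    have "0 < l" using n by (intro gr0I) (auto simp: block_def floorlog_def)
    have "l \<le> 2 * m ^ Suc n" using True n by simp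
    also have "\<dots> \<le> \<gamma> * m ^ Suc n" using gm by (intro mult_right_mono) auto
    finally have "Rterm w \<alpha> p m (Suc n) k l \<le> R n" unfolding R_def
      using block_bounds(1)[OF m \<open>0 < l\<close>] n by (intro SUP_upper) auto
    then show ?thesis using suminf_cross_le_Rterm[of m l w p k \<alpha>] True n by (simp add: order_trans)
  qed (auto simp: cross_def)
  show "(\<Sum>j. cross w p m k l j) < \<top>"
  proof (cases "1 \<le> k")
    case True
    then have "R n < \<top>" for n
      using Rsum ennreal_suminf_lessD[of R] by (simp add: R_def)
    then show ?thesis using le by (rule le_less_trans[rotated])
  qed (auto simp: cross_def)
  show "(\<lambda>l. \<Sum>j. cross w p m k l j) \<longlonglongrightarrow> 0"
  proof (cases "1 \<le> k")
    case True
    have "(\<lambda>n. R n) \<longlonglongrightarrow> 0"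
    proof (rule tendsto_sandwich[OF _ _ tendsto_const])
      show "(\<lambda>N. \<Sum>i. R (i + N)) \<longlonglongrightarrow> 0"
        using Rsum[OF True] by (intro ennreal_suminf_tail_tendsto_0) (simp add: R_def)
      have "R n \<le> (\<Sum>i. R (i + n))" for n
        using sum_le_suminf[of "\<lambda>i. R (i + n)" "{0}"] by simp
      then show "eventually (\<lambda>n. R n \<le> (\<Sum>i. R (i + n))) sequentially" by simp
    qed simp
    moreover have "filterlim (\<lambda>l. block m l - 1) at_top sequentially"
      using filterlim_compose[OF filterlim_minus_const_nat_at_top block_at_top[OF m], of 1] by simp
    ultimately have "(\<lambda>l. R (block m l - 1)) \<longlonglongrightarrow> 0" by (rule filterlim_compose)
    then show ?thesis by (rule tendsto_sandwich[OF _ _ tendsto_const, rotated 2])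
      (intro always_eventually allI le zero_le)+
  qed (auto simp: cross_def)
qed

subsection \<open>The common frequently hypercyclic vector\<close>

theorem theorem4p2:
  fixes p :: real and w :: "nat \<Rightarrow> nat \<Rightarrow> complex"
    and \<gamma> m :: nat and \<alpha> :: "nat \<Rightarrow> real" and \<epsilon> :: real
  assumes p: "1 \<le> p"
    and weights: "\<forall>k\<ge>1. is_weight (w k)"
    and inf_pos: "\<forall>n. (INF k\<in>{1..}. norm (Wprod (w k) n)) > 0"
    and growth: "\<forall>k\<ge>1. \<exists>C>0. \<exists>\<tau>>0. \<forall>n\<ge>1.
        norm (Wprod (w k) n) powr (-p) \<le> C * (1 / real n) * ln (real n + 1) powr (-(1 + p / 2 + \<tau>))"
    and gm: "2 \<le> \<gamma>" "\<gamma> < m"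
    and alpha_mono: "mono \<alpha>" and alpha_pos: "\<forall>l. \<alpha> l > 0"
    and alpha_lim: "filterlim \<alpha> at_top sequentially"
    and eps: "\<epsilon> > 0"
    and alpha_sum: "(\<lambda>l. \<Sum>i\<le>l. \<alpha> i) \<in> O(\<lambda>l. real l ^ 2 / ln (real l) powr (1 + \<epsilon>))"
    and Rsum: "\<forall>k\<ge>1. (\<Sum>n. (SUP l\<in>{m ^ (Suc n) .. \<gamma> * m ^ (Suc n)}. Rterm w \<alpha> p m (Suc n) k l)) < \<top>"
  shows "\<exists>(M :: (nat \<Rightarrow> real) measure) (X :: (nat \<Rightarrow> real) \<Rightarrow> (nat \<Rightarrow> complex)).
           prob_space M \<and> X \<in> borel_measurable M \<and>
           (AE \<omega> in M. X \<omega> \<in> lp p \<and> (\<forall>k\<ge>1. freq_hypercyclic p (bshift (w k)) (X \<omega>)))"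
proof -
  obtain Q :: "complex set" where Q: "countable Q" "\<And>X. open X \<Longrightarrow> X \<noteq> {} \<Longrightarrow> \<exists>q\<in>Q. q \<in> X"
    using countable_dense_exists[where ?'a = complex] by (elim exE conjE) (rule that, auto)
  \<comment> \<open>All requests: a weight, a finitely supported vector over \<open>Q\<close>, and
    an accuracy.\<close>
  define J where "J = {1::nat..} \<times> lists Q \<times> (UNIV :: nat set)"
  define \<phi> where "\<phi> = from_nat_into J"
  have "countable J" "J \<noteq> {}" using Q(1) by (auto simp: J_def)
  then have \<phi>: "range \<phi> = J" by (simp add: \<phi>_def)
  define \<kappa> y \<delta> where "\<kappa> s = fst (\<phi> s)" and "y s = fst (snd (\<phi> s))" and "\<delta> s = 1 / real (Suc (snd (snd (\<phi> s))))" for s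
  have \<kappa>: "1 \<le> \<kappa> s" for s
  proof -
    have "\<phi> s \<in> J" using \<phi> by auto
    then show ?thesis by (auto simp: J_def \<kappa>_def)
  qed
  have m: "2 < m" using gm by simp
  have inv_fin: "psum p (\<lambda>j. 1 / Wprod (w k) j) < \<top>" if k: "1 \<le> k" for k
  proof -
    from growth k obtain C \<tau> where "\<tau> > 0"
      "\<forall>n\<ge>1. norm (Wprod (w k) n) powr (-p) \<le> C * (1 / real n) * ln (real n + 1) powr (-(1 + p / 2 + \<tau>))"
      by blast
    then show ?thesis by (intro psum_inverse_Wprod_finite[OF p]) auto
  qed
  have "\<exists>x\<in>lp p. \<forall>s. \<exists>D>0. \<exists>n0. \<forall>n\<ge>n0. multiplicity 2 n = s \<longrightarrow>
    (\<forall>l\<in>{m^n..2*m^n}. D dvd l \<longrightarrow>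
       psum p (\<lambda>i. (bshift (w (\<kappa> s)) ^^ l) x i - fin_vec (y s) i) \<le> ennreal (\<delta> s))"
  proof (rule exists_block_vector[OF p m _ _ inv_fin _ _ \<kappa>])
    show "is_weight (w k)" if "1 \<le> k" for k using weights that by blast
    show "0 < inf_Wprod w j" for j using inf_pos by (simp add: inf_Wprod_def)
    have m1: "1 < m" using m by simp
    show "(\<Sum>j. cross w p m k l j) < \<top>" "(\<lambda>l. \<Sum>j. cross w p m k l j) \<longlonglongrightarrow> 0" for k l
      using cross_lim[OF m1 gm(1) Rsum[rule_format]] by blast+
    show "0 < \<delta> s" for s by (simp add: \<delta>_def)
  qed
  then obtain x where x: "x \<in> lp p" and hits: "\<And>s. \<exists>D>0. \<exists>n0. \<forall>n\<ge>n0. multiplicity 2 n = s \<longrightarrow>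
    (\<forall>l\<in>{m^n..2*m^n}. D dvd l \<longrightarrow>
       psum p (\<lambda>i. (bshift (w (\<kappa> s)) ^^ l) x i - fin_vec (y s) i) \<le> ennreal (\<delta> s))"
    by (elim bexE) (rule that, assumption, elim allE)
  have "freq_hypercyclic p (bshift (w k)) x" if k: "1 \<le> k" for k
    unfolding freq_hypercyclic_def
  proof (intro conjI allI impI x)
    fix U assume U: "lp_open p U \<and> U \<noteq> {}"
    obtain v t where v: "v \<in> lists Q"
      and U': "\<And>z. psum p (\<lambda>i. z i - fin_vec v i) \<le> ennreal (1 / real (Suc t)) \<Longrightarrow> z \<in> U"
      using lp_open_contains_fin_vec_ball[OF p, of U Q] U Q(2) by blast
    \<comment> \<open>The ball found inside \<open>U\<close> is one of the enumerated targets for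
      the weight \<open>k\<close>, so suitable multiples in its windows are hitting times.\<close>
    have "(k, v, t) \<in> range \<phi>" using k v unfolding \<phi> J_def by simp
    then obtain s where "\<phi> s = (k, v, t)" by (metis imageE)
    then have s: "\<kappa> s = k" "y s = v" "\<delta> s = 1 / real (Suc t)" by (auto simp: \<kappa>_def y_def \<delta>_def)
    from hits[of s] obtain D n0 where D: "0 < D" and hit: "\<And>n l. n0 \<le> n \<Longrightarrow> multiplicity 2 n = s \<Longrightarrow>
        l \<in> {m^n..2*m^n} \<Longrightarrow> D dvd l \<Longrightarrow>
        psum p (\<lambda>i. (bshift (w k) ^^ l) x i - fin_vec v i) \<le> ennreal (1 / real (Suc t))"
      unfolding s by blast
    show "pos_lower_density {n. (bshift (w k) ^^ n) x \<in> U}"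
    proof (rule pos_lower_density_blocks)
      show "{l\<in>{m^n..2*m^n}. D dvd l} \<subseteq> {n. (bshift (w k) ^^ n) x \<in> U}"
        if "n0 \<le> n" "multiplicity 2 n = s" for n
        using hit[OF that] U' by blast
    qed (use m D in auto)
  qed
  \<comment> \<open>The probability space is a point mass and the random vector is the constant
    \<open>x\<close>.\<close>
  then show ?thesis
    using x by (intro exI[of _ "return borel (\<lambda>_. 0)"] exI[of _ "\<lambda>_. x"])
      (auto intro!: prob_space_return)
qed

end
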